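(* Let $n\ge1$, $r\ge1$ be integers, let $\beta\in\mathbb{Z}_n$, and let $l=\gcd(\beta,n)$. Let $N_\beta$ be the number of matrices $X\in\mathrm{GL}_r(\mathbb{Z}_n)$ with $\mathrm{tr}\,X=\beta$. Then $$N_\beta=\frac{1}{\varphi(n/l)}\,n^{\frac{r(r-1)}{2}-1}\sum_{d\mid n}C_{n/l}(d)\,C_n(d)^r\,\varphi(n/d)\,d^{\frac{r(r-1)}{2}}\prod_{\substack{p\mid n\\ p\nmid n/d}}\prod_{i=1}^r\frac{1-p^{-i}}{1-p^{-1}},$$ where $d$ runs over positive divisors of $n$ and the outer product is over primes $p$.
   Context: $\mathbb{Z}_n=\mathbb{Z}/n\mathbb{Z}$, $\mathrm{GL}_r(\mathbb{Z}_n)$ the invertible $r\times r$ matrices over $\mathbb{Z}_n$; $\gcd(\beta,n)$ means the gcd of any integer representative of $\beta$ with $n$ (so $l=n$ when $\beta=0$). $\varphi$ is Euler's totient function. For positive integers $m$ and integers $k$, the Ramanujan sum is $C_m(k)=\sum_{j\in\mathbb{Z}_m^*}\exp\left(\frac{2\pi\sqrt{-1}\,jk}{m}\right)$. *)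

theory Defs
  imports Complex_Main "HOL-Number_Theory.Totient" "HOL-Number_Theory.Cong"
    "Jordan_Normal_Form.Matrix"
begin

(* The ring of integers modulo n is represented by the residues 0, ..., n - 1 with arithmetic
   modulo n. The unit matrix is also reduced modulo n, so that n = 1 gives the zero ring. *)

definition mat_mod :: "nat \<Rightarrow> int mat \<Rightarrow> int mat" where
  "mat_mod n A = map_mat (\<lambda>a. a mod int n) A"

definition residue_mat_monoid :: "nat \<Rightarrow> nat \<Rightarrow> int mat monoid" where
  "residue_mat_monoid r n =
     \<lparr>carrier = {A \<in> carrier_mat r r. \<forall>i<r. \<forall>j<r. A $$ (i, j) \<in> {0..<int n}},
      monoid.mult = (\<lambda>A B. mat_mod n (A * B)),
      one = mat_mod n (1\<^sub>m r)\<rparr>"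

definition GL_residue :: "nat \<Rightarrow> nat \<Rightarrow> int mat set" where
  "GL_residue r n = Units (residue_mat_monoid r n)"

definition residue_trace :: "nat \<Rightarrow> int mat \<Rightarrow> int" where
  "residue_trace n A = (\<Sum>i<dim_row A. A $$ (i, i)) mod int n"

(* The summand only depends on j modulo m; totatives m represents the units modulo m
   within {1..m}, and totatives 1 = {1}. *)
definition ramanujan_sum :: "nat \<Rightarrow> int \<Rightarrow> complex" where
  "ramanujan_sum m k =
     (\<Sum>j\<in>totatives m. exp (2 * complex_of_real pi * \<i> * of_nat j * of_int k / of_nat m))"

end

theory Submission
  imports Defs "Jordan_Normal_Form.Determinant"
begin

text \<open>Detecting the trace by additive characters, \<open>n N\<^sub>\<beta>\<close> is the sum over \<open>k\<close> modulo \<open>n\<close> of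
  \<open>e(-k \<beta> / n) S(k)\<close>, where \<open>S(k)\<close> sums \<open>e(k tr X / n)\<close> over the invertible matrices. For
  \<open>k = d j\<close> with \<open>d = gcd(k, n)\<close> the summand only depends on \<open>X\<close> modulo \<open>m = n / d\<close>, and the fibres
  of reduction contribute the factor \<open>d\<close> to the power \<open>r * r\<close> times, for each prime \<open>p\<close> dividing \<open>n\<close>
  but not \<open>m\<close>, the density of invertible matrices modulo \<open>p\<close>. For \<open>j\<close> coprime to \<open>m\<close>, matrices with a
  given first column contribute 0 unless that column is \<open>(x, 0, \<dots>, 0)\<close>; peeling off this column
  gives by induction \<open>m\<close> to the power \<open>r (r - 1) / 2\<close> times \<open>C\<^sub>m(1)\<close> to the power \<open>r\<close>. The case
  \<open>r = 1\<close> of the same reduction step relates \<open>C\<^sub>n(d k)\<close> to \<open>C\<^sub>m(k)\<close>, which turns the result into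
  the stated form.\<close>

section \<open>Additive characters\<close>

definition echar :: "nat \<Rightarrow> int \<Rightarrow> complex" where
  "echar m k = cis (2 * pi * of_int k / of_nat m)"

lemma echar_0 [simp]: "echar m 0 = 1"
  by (simp add: echar_def)

lemma echar_add: "echar m (a + b) = echar m a * echar m b"
  by (simp add: echar_def cis_mult ring_distribs add_divide_distrib)

lemma echar_power: "echar m a ^ k = echar m (a * int k)"
  by (simp add: echar_def DeMoivre mult_ac)

lemma echar_mult_cancel: "d > 0 \<Longrightarrow> echar (d * m) (int d * a) = echar m a"
  by (simp add: echar_def mult.assoc)

lemma echar_eq_1_iff:
  assumes "m > 0"
  shows "echar m a = 1 \<longleftrightarrow> int m dvd a"
proof
  assume "echar m a = 1"
  then have "cos (2 * pi * of_int a / of_nat m) = 1"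
    by (simp add: echar_def complex_eq_iff)
  then obtain k :: int where "2 * pi * of_int a / of_nat m = of_int k * 2 * pi"
    using cos_one_2pi_int by blast
  then have "pi * real_of_int a = pi * real_of_int (int m * k)"
    using assms by (simp add: divide_simps mult_ac)
  then have "a = int m * k"
    by (simp only: mult_cancel_left pi_neq_zero simp_thms of_int_eq_iff)
  then show "int m dvd a" by simp
next
  assume "int m dvd a"
  then obtain k where "a = int m * k" ..
  then show "echar m a = 1"
    using assms cis_multiple_2pi[of "of_int k"] by (simp add: echar_def mult.assoc)
qed

lemma echar_cong:
  assumes "m > 0" "[a = b] (mod int m)"
  shows "echar m a = echar m b"
proof -
  have "echar m (a - b) = 1"
    using assms by (simp add: echar_eq_1_iff cong_iff_dvd_diff)
  then show ?thesis
    using echar_add[of m "a - b" b] by simp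
qed

text \<open>Orthogonality: for \<open>a\<close> not divisible by \<open>n\<close> this is a
  geometric series in an \<open>n\<close>-th root of unity other than 1. The range
  \<open>{0<..n}\<close> fits the later grouping by \<open>gcd k n\<close>, where
  \<open>k = n\<close> stands for the zero residue.\<close>

lemma sum_echar:
  assumes "n > 0"
  shows "(\<Sum>k\<in>{0<..n}. echar n (int k * a)) = (if int n dvd a then of_nat n else 0)"
proof (cases "int n dvd a")
  case True
  then have "echar n (int k * a) = 1" for k
    using assms by (simp add: echar_eq_1_iff)
  with True show ?thesis by simp
next
  case False
  define z where "z = echar n a"
  have "z \<noteq> 1" "z ^ n = 1"
    using False assms by (simp_all add: z_def echar_eq_1_iff echar_power)
  have "(\<Sum>k\<in>{0<..n}. echar n (int k * a)) = (\<Sum>k\<in>{0<..n}. z ^ k)"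
    by (simp add: z_def echar_power mult.commute)
  also have "\<dots> = (\<Sum>k\<in>Suc ` {..<n}. z ^ k)"
    by (intro sum.cong) (auto simp: image_iff Suc_le_eq gr0_conv_Suc)
  also have "\<dots> = z * (\<Sum>k<n. z ^ k)"
    by (simp add: sum.reindex sum_distrib_left)
  also have "\<dots> = 0"
    using \<open>z \<noteq> 1\<close> \<open>z ^ n = 1\<close> by (simp add: geometric_sum)
  finally show ?thesis using False by simp
qed

lemma ramanujan_sum_echar:
  "ramanujan_sum m k = (\<Sum>j\<in>totatives m. echar m (int j * k))"
proof -
  have "exp (2 * complex_of_real pi * \<i> * of_nat j * of_int k / of_nat m) = echar m (int j * k)" for j
    by (simp add: echar_def cis_conv_exp mult_ac)
  then show ?thesis by (simp add: ramanujan_sum_def)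
qed

section \<open>Invertible matrices over the residues\<close>

definition residue_mats :: "nat \<Rightarrow> nat \<Rightarrow> int mat set" where
  "residue_mats r n = {A \<in> carrier_mat r r. \<forall>i<r. \<forall>j<r. A $$ (i, j) \<in> {0..<int n}}"

text \<open>Invertibility is expressed through the integer determinant, which is compatible with
  reduction and with block triangular shapes; \<open>GL_residue_eq_unit_mats\<close> identifies this
  set with the group of units.\<close>

definition unit_mats :: "nat \<Rightarrow> nat \<Rightarrow> int mat set" where
  "unit_mats r n = {A \<in> residue_mats r n. coprime (det A) (int n)}"

text \<open>Kept as an integer, without reduction: a trace is viewed modulo several moduli, and
  \<open>echar n\<close> only sees its residue.\<close>

definition mat_trace :: "int mat \<Rightarrow> int" where
  "mat_trace A = (\<Sum>i<dim_row A. A $$ (i, i))"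

lemma residue_mats_carrier: "A \<in> residue_mats r n \<Longrightarrow> A \<in> carrier_mat r r"
  by (simp add: residue_mats_def)

lemma unit_mats_carrier: "A \<in> unit_mats r n \<Longrightarrow> A \<in> carrier_mat r r"
  by (simp add: unit_mats_def residue_mats_def)

lemma mat_mod_carrier [simp]: "mat_mod n A \<in> carrier_mat r c \<longleftrightarrow> A \<in> carrier_mat r c"
  by (simp add: mat_mod_def)

lemma dim_mat_mod [simp]: "dim_row (mat_mod n A) = dim_row A" "dim_col (mat_mod n A) = dim_col A"
  by (simp_all add: mat_mod_def)

lemma index_mat_mod [simp]:
  "i < dim_row A \<Longrightarrow> j < dim_col A \<Longrightarrow> mat_mod n A $$ (i, j) = A $$ (i, j) mod int n"
  by (simp add: mat_mod_def)

lemma mat_mod_residue_mats: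
  "n > 0 \<Longrightarrow> A \<in> carrier_mat r r \<Longrightarrow> mat_mod n A \<in> residue_mats r n"
  by (auto simp: residue_mats_def)

lemma mat_mod_id: "A \<in> residue_mats r n \<Longrightarrow> mat_mod n A = A"
  by (auto simp: residue_mats_def intro!: eq_matI)

lemma mat_mod_mod: "m dvd n \<Longrightarrow> mat_mod m (mat_mod n A) = mat_mod m A"
  by (intro eq_matI) (auto simp: mod_mod_cancel)

lemma cong_mat_trace_mat_mod:
  assumes "A \<in> carrier_mat r r"
  shows "[mat_trace (mat_mod n A) = mat_trace A] (mod int n)"
  using assms by (auto simp: mat_trace_def intro!: cong_sum)

text \<open>The Leibniz expansion makes the determinant an integer polynomial in the entries, so
  congruent entries give congruent determinants.\<close>

lemma cong_det_mat_mod: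
  assumes "A \<in> carrier_mat r r"
  shows "[det (mat_mod n A) = det A] (mod int n)"
proof -
  have "[(\<Prod>i = 0..<r. mat_mod n A $$ (i, p i)) = (\<Prod>i = 0..<r. A $$ (i, p i))] (mod int n)"
    if "p permutes {0..<r}" for p
    using assms that by (intro cong_prod) (auto simp: cong_def permutes_in_image)
  then have "[(\<Sum>p\<in>{p. p permutes {0..<r}}. signof p * (\<Prod>i = 0..<r. mat_mod n A $$ (i, p i))) =
         (\<Sum>p\<in>{p. p permutes {0..<r}}. signof p * (\<Prod>i = 0..<r. A $$ (i, p i)))] (mod int n)"
    by (intro cong_sum cong_mult[OF cong_refl]) simp
  then show ?thesis
    by (simp only: det_def'[OF assms] det_def'[OF iffD2[OF mat_mod_carrier assms]])
qed

lemma coprime_det_mat_mod: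
  assumes "A \<in> carrier_mat r r"
  shows "coprime (det (mat_mod n A)) (int n) \<longleftrightarrow> coprime (det A) (int n)"
  using cong_det_mat_mod[OF assms] by (meson cong_imp_coprime cong_sym)

lemma mat_mod_unit_mats_iff:
  "n > 0 \<Longrightarrow> A \<in> carrier_mat r r \<Longrightarrow> mat_mod n A \<in> unit_mats r n \<longleftrightarrow> coprime (det A) (int n)"
  by (simp add: unit_mats_def mat_mod_residue_mats coprime_det_mat_mod)

lemma mat_mod_smult_cong:
  assumes "[a = b] (mod int n)"
  shows "mat_mod n (a \<cdot>\<^sub>m A) = mat_mod n (b \<cdot>\<^sub>m A)"
proof (intro eq_matI, goal_cases)
  case (1 i j)
  then show ?case
    using cong_mult[OF assms cong_refl[of "A $$ (i, j)"]] by (simp add: cong_def)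
qed simp_all

lemma mat_mod_mult_right:
  assumes "A \<in> carrier_mat r r" "B \<in> carrier_mat r r"
  shows "mat_mod n (A * mat_mod n B) = mat_mod n (A * B)"
proof (intro eq_matI, goal_cases)
  case (1 i j)
  have "[(\<Sum>k = 0..<r. A $$ (i, k) * mat_mod n B $$ (k, j)) =
         (\<Sum>k = 0..<r. A $$ (i, k) * B $$ (k, j))] (mod int n)"
    using assms 1 by (intro cong_sum cong_mult[OF cong_refl]) (simp add: cong_def)
  then have "[(A * mat_mod n B) $$ (i, j) = (A * B) $$ (i, j)] (mod int n)"
    using assms 1 by (simp add: scalar_prod_def)
  then show ?case using assms 1 unfolding cong_def by (subst (1 2) index_mat_mod) auto
qed (use assms in auto)

lemma mat_mod_mult_left:
  assumes "A \<in> carrier_mat r r" "B \<in> carrier_mat r r"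
  shows "mat_mod n (mat_mod n A * B) = mat_mod n (A * B)"
proof (intro eq_matI, goal_cases)
  case (1 i j)
  have "[(\<Sum>k = 0..<r. mat_mod n A $$ (i, k) * B $$ (k, j)) =
         (\<Sum>k = 0..<r. A $$ (i, k) * B $$ (k, j))] (mod int n)"
    using assms 1 by (intro cong_sum cong_mult[OF _ cong_refl]) (simp add: cong_def)
  then have "[(mat_mod n A * B) $$ (i, j) = (A * B) $$ (i, j)] (mod int n)"
    using assms 1 by (simp add: scalar_prod_def)
  then show ?case using assms 1 unfolding cong_def by (subst (1 2) index_mat_mod) auto
qed (use assms in auto)

text \<open>Multiplicativity makes the determinant of an invertible matrix a unit modulo
  \<open>n\<close>; conversely the adjugate, scaled by an inverse \<open>t\<close> of
  \<open>det X\<close> modulo \<open>n\<close>, is a two-sided inverse.\<close>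

lemma GL_residue_eq_unit_mats:
  assumes "n > 0"
  shows "GL_residue r n = unit_mats r n"
proof (intro equalityI subsetI)
  fix X assume "X \<in> GL_residue r n"
  then obtain Y where X: "X \<in> residue_mats r n" and Y: "Y \<in> carrier_mat r r"
    and XY: "mat_mod n (X * Y) = mat_mod n (1\<^sub>m r)"
    by (auto simp: GL_residue_def Units_def residue_mat_monoid_def residue_mats_def)
  note X' = residue_mats_carrier[OF X]
  have "[det (X * Y) = det (mat_mod n (X * Y))] (mod int n)"
    using X' Y by (intro cong_sym[OF cong_det_mat_mod[of _ r]]) auto
  also have "det (mat_mod n (X * Y)) = det (mat_mod n (1\<^sub>m r))"
    by (simp only: XY)
  also have "[\<dots> = det (1\<^sub>m r :: int mat)] (mod int n)"
    by (intro cong_det_mat_mod[of _ r]) auto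
  finally have "[det X * det Y = 1] (mod int n)"
    using X' Y by (simp add: det_mult)
  then have "coprime (det X) (int n)"
    by (meson coprime_iff_invertible_int)
  with X show "X \<in> unit_mats r n" by (simp add: unit_mats_def)
next
  fix X assume *: "X \<in> unit_mats r n"
  then have X: "X \<in> carrier_mat r r" and R: "X \<in> residue_mats r n"
    by (auto simp: unit_mats_def residue_mats_def)
  from * obtain t where t: "[det X * t = 1] (mod int n)"
    unfolding unit_mats_def using coprime_iff_invertible_int by blast
  define B where "B = t \<cdot>\<^sub>m adj_mat X"
  note adj = adj_mat[OF X]
  have B: "B \<in> carrier_mat r r"
    using adj by (simp add: B_def)
  have t': "[t * det X = 1] (mod int n)"
    using t by (simp add: mult.commute)
  have one_smult: "1 \<cdot>\<^sub>m 1\<^sub>m r = (1\<^sub>m r :: int mat)"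
    by (intro eq_matI) auto
  have smult2: "t \<cdot>\<^sub>m (det X \<cdot>\<^sub>m 1\<^sub>m r) = (t * det X) \<cdot>\<^sub>m 1\<^sub>m r"
    by (intro eq_matI) auto
  have "X * B = (t * det X) \<cdot>\<^sub>m 1\<^sub>m r" "B * X = (t * det X) \<cdot>\<^sub>m 1\<^sub>m r"
    unfolding B_def by (simp_all only: mult_smult_distrib[OF X adj(1)]
      mult_smult_assoc_mat[OF adj(1) X] adj(2,3) smult2)
  then have "mat_mod n (X * B) = mat_mod n (1 \<cdot>\<^sub>m 1\<^sub>m r)" "mat_mod n (B * X) = mat_mod n (1 \<cdot>\<^sub>m 1\<^sub>m r)"
    by (simp_all only: mat_mod_smult_cong[OF t'])
  then have "mat_mod n (X * mat_mod n B) = mat_mod n (1\<^sub>m r)"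
            "mat_mod n (mat_mod n B * X) = mat_mod n (1\<^sub>m r)"
    by (simp_all only: mat_mod_mult_left[OF B X] mat_mod_mult_right[OF X B] one_smult)
  then have "\<exists>Y\<in>residue_mats r n. mat_mod n (Y * X) = mat_mod n (1\<^sub>m r) \<and>
      mat_mod n (X * Y) = mat_mod n (1\<^sub>m r)"
    using mat_mod_residue_mats[OF assms B] by blast
  with R show "X \<in> GL_residue r n"
    by (auto simp: GL_residue_def Units_def residue_mat_monoid_def residue_mats_def)
qed

section \<open>Lifting along residue maps\<close>

lemma bij_betw_residue_mats:
  "bij_betw (mat r r) ({..<r} \<times> {..<r} \<rightarrow>\<^sub>E {0..<int n}) (residue_mats r n)"
proof (rule bij_betw_byWitness[where f' = "\<lambda>A. restrict (\<lambda>ij. A $$ ij) ({..<r} \<times> {..<r})"])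
  show "\<forall>g\<in>{..<r} \<times> {..<r} \<rightarrow>\<^sub>E {0..<int n}.
      restrict (\<lambda>ij. mat r r g $$ ij) ({..<r} \<times> {..<r}) = g"
    by (auto simp: PiE_iff extensional_def restrict_def fun_eq_iff)
  show "\<forall>A\<in>residue_mats r n. mat r r (restrict (\<lambda>ij. A $$ ij) ({..<r} \<times> {..<r})) = A"
    by (auto simp: residue_mats_def intro!: eq_matI)
  show "mat r r ` ({..<r} \<times> {..<r} \<rightarrow>\<^sub>E {0..<int n}) \<subseteq> residue_mats r n"
  proof safe
    fix g assume "g \<in> {..<r} \<times> {..<r} \<rightarrow>\<^sub>E {0..<int n}"
    then have "g (i, j) \<in> {0..<int n}" if "i < r" "j < r" for i j
      using PiE_mem[of g "{..<r} \<times> {..<r}" "\<lambda>_. {0..<int n}" "(i, j)"] that by simp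
    then show "mat r r g \<in> residue_mats r n"
      by (simp add: residue_mats_def)
  qed
  show "(\<lambda>A. restrict (\<lambda>ij. A $$ ij) ({..<r} \<times> {..<r})) ` residue_mats r n
      \<subseteq> {..<r} \<times> {..<r} \<rightarrow>\<^sub>E {0..<int n}"
    by (auto simp: residue_mats_def split: if_splits)
qed

lemma card_residue_mats: "card (residue_mats r n) = n ^ (r * r)"
  using bij_betw_same_card[OF bij_betw_residue_mats[of r n]] by (simp add: card_PiE)

lemma finite_residue_mats [simp]: "finite (residue_mats r n)"
  using bij_betw_finite[OF bij_betw_residue_mats[of r n]] by (simp add: finite_PiE)

lemma finite_unit_mats [simp]: "finite (unit_mats r n)"
  by (rule finite_subset[OF _ finite_residue_mats[of r n]]) (auto simp: unit_mats_def)

text \<open>In a lift of \<open>Y\<close>, the part \<open>Z\<close> is the matrix of quotients by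
  \<open>m\<close>. Since \<open>q\<close> divides \<open>m\<close>, coprimality to
  \<open>m * q\<close> and to \<open>m\<close> agree, so every lift of an invertible matrix is
  invertible.\<close>

lemma bij_betw_lift_dvd:
  assumes "m > 0" "q dvd m"
  shows "bij_betw (\<lambda>(Y, Z). Y + int m \<cdot>\<^sub>m Z) (unit_mats r m \<times> residue_mats r q)
    (unit_mats r (m * q))"
proof (rule bij_betw_byWitness[where f' = "\<lambda>X. (mat_mod m X, map_mat (\<lambda>a. a div int m) X)"])
  have cop: "coprime a (int (m * q)) \<longleftrightarrow> coprime a (int m)" for a
    using assms(2) by (auto intro: coprime_divisors[of a a])
  have mod: "mat_mod m (Y + int m \<cdot>\<^sub>m Z) = Y"
    if "Y \<in> residue_mats r m" "Z \<in> carrier_mat r r" for Y Z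
    using that by (intro eq_matI) (auto simp: residue_mats_def)
  show "\<forall>YZ\<in>unit_mats r m \<times> residue_mats r q.
     (mat_mod m (case YZ of (Y, Z) \<Rightarrow> Y + int m \<cdot>\<^sub>m Z),
      map_mat (\<lambda>a. a div int m) (case YZ of (Y, Z) \<Rightarrow> Y + int m \<cdot>\<^sub>m Z)) = YZ"
    using assms(1) mod
    by (auto simp: unit_mats_def residue_mats_def intro!: eq_matI)
  show "\<forall>X\<in>unit_mats r (m * q).
     (case (mat_mod m X, map_mat (\<lambda>a. a div int m) X) of (Y, Z) \<Rightarrow> Y + int m \<cdot>\<^sub>m Z) = X"
    by (auto simp: unit_mats_def residue_mats_def intro!: eq_matI)
  show "(\<lambda>(Y, Z). Y + int m \<cdot>\<^sub>m Z) ` (unit_mats r m \<times> residue_mats r q) \<subseteq> unit_mats r (m * q)"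
  proof safe
    fix Y Z assume Y: "Y \<in> unit_mats r m" and Z: "Z \<in> residue_mats r q"
    note YZ = unit_mats_carrier[OF Y] residue_mats_carrier[OF Z]
    have C: "Y + int m \<cdot>\<^sub>m Z \<in> carrier_mat r r"
      using YZ by simp
    have "mat_mod m (Y + int m \<cdot>\<^sub>m Z) \<in> unit_mats r m"
      using mod Y YZ by (simp add: unit_mats_def)
    then have "coprime (det (Y + int m \<cdot>\<^sub>m Z)) (int (m * q))"
      unfolding cop using mat_mod_unit_mats_iff[OF assms(1) C] by simp
    moreover have "Y + int m \<cdot>\<^sub>m Z \<in> residue_mats r (m * q)"
    proof -
      have "0 \<le> y + int m * z \<and> y + int m * z < int m * int q"
        if "0 \<le> y" "y < int m" "0 \<le> z" "z < int q" for y z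
      proof -
        have "int m * (z + 1) \<le> int m * int q"
          using that by (intro mult_left_mono) auto
        with that show ?thesis by (simp add: ring_distribs)
      qed
      then show ?thesis
        using Y Z by (auto simp: unit_mats_def residue_mats_def)
    qed
    ultimately show "Y + int m \<cdot>\<^sub>m Z \<in> unit_mats r (m * q)"
      by (simp add: unit_mats_def)
  qed
  show "(\<lambda>X. (mat_mod m X, map_mat (\<lambda>a. a div int m) X)) ` unit_mats r (m * q)
      \<subseteq> unit_mats r m \<times> residue_mats r q"
  proof safe
    fix X assume X: "X \<in> unit_mats r (m * q)"
    then have "coprime (det X) (int m)"
      using cop[of "det X"] by (simp only: unit_mats_def mem_Collect_eq)
    then show "mat_mod m X \<in> unit_mats r m"
      using mat_mod_unit_mats_iff[OF assms(1) unit_mats_carrier[OF X]] by blast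
    have "0 \<le> a div int m \<and> a div int m < int q" if "0 \<le> a" "a < int m * int q" for a
    proof -
      have "int m * (a div int m) + a mod int m = a" "0 \<le> a mod int m"
        using assms(1) by simp_all
      then have "int m * (a div int m) < int m * int q"
        using that(2) by linarith
      then show ?thesis
        using assms(1) that(1) by (simp add: pos_imp_zdiv_nonneg_iff)
    qed
    then show "map_mat (\<lambda>a. a div int m) X \<in> residue_mats r q"
      using X by (auto simp: unit_mats_def residue_mats_def)
  qed
qed

text \<open>The Chinese remainder theorem works entry by entry, and a determinant is coprime to
  \<open>m * q\<close> exactly when it is coprime to both factors.\<close>

lemma bij_betw_crt:
  assumes "m > 0" "q > 0" "coprime m q"
  shows "bij_betw (\<lambda>X. (mat_mod m X, mat_mod q X)) (unit_mats r (m * q))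
    (unit_mats r m \<times> unit_mats r q)"
  unfolding bij_betw_def
proof (intro conjI inj_onI equalityI subsetI)
  fix X Y assume X: "X \<in> unit_mats r (m * q)" and Y: "Y \<in> unit_mats r (m * q)"
    and eq: "(mat_mod m X, mat_mod q X) = (mat_mod m Y, mat_mod q Y)"
  note C = unit_mats_carrier[OF X] unit_mats_carrier[OF Y]
  show "X = Y"
  proof (intro eq_matI, goal_cases)
    case (1 i j)
    then have ij: "i < r" "j < r" using C by auto
    have "mat_mod m X $$ (i, j) = mat_mod m Y $$ (i, j)" "mat_mod q X $$ (i, j) = mat_mod q Y $$ (i, j)"
      using eq by simp_all
    then have "[X $$ (i, j) = Y $$ (i, j)] (mod int m)" "[X $$ (i, j) = Y $$ (i, j)] (mod int q)"
      using ij C by (simp_all add: cong_def)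
    then have "[X $$ (i, j) = Y $$ (i, j)] (mod int (m * q))"
      using assms(3) by (simp add: coprime_cong_mult)
    moreover have "X $$ (i, j) \<in> {0..<int (m * q)}" "Y $$ (i, j) \<in> {0..<int (m * q)}"
      using X Y ij unfolding unit_mats_def residue_mats_def by blast+
    ultimately show ?case by (simp add: cong_def)
  qed (use C in auto)
next
  fix YZ assume "YZ \<in> (\<lambda>X. (mat_mod m X, mat_mod q X)) ` unit_mats r (m * q)"
  then obtain X where X: "X \<in> unit_mats r (m * q)" "YZ = (mat_mod m X, mat_mod q X)" by auto
  then have "coprime (det X) (int m)" "coprime (det X) (int q)"
    by (simp_all add: unit_mats_def)
  with X assms unit_mats_carrier[OF X(1)] show "YZ \<in> unit_mats r m \<times> unit_mats r q"
    by (simp add: mat_mod_unit_mats_iff)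
next
  fix YZ assume "YZ \<in> unit_mats r m \<times> unit_mats r q"
  then obtain Y Z where YZ: "YZ = (Y, Z)" "Y \<in> unit_mats r m" "Z \<in> unit_mats r q" by auto
  have "\<exists>x. [x = Y $$ ij] (mod int m) \<and> [x = Z $$ ij] (mod int q)" for ij
    using assms(3) by (intro binary_chinese_remainder_int) simp
  \<comment> \<open>These entries are unreduced integers; reduction modulo \<open>m * q\<close> at
    the end puts them in range.\<close>
  then obtain g where g: "\<And>ij. [g ij = Y $$ ij] (mod int m)" "\<And>ij. [g ij = Z $$ ij] (mod int q)"
    by metis
  define X where "X = mat r r g"
  have X: "X \<in> carrier_mat r r" by (simp add: X_def)
  have mq: "mat_mod m X = Y" "mat_mod q X = Z"
    using YZ g by (auto simp: X_def unit_mats_def residue_mats_def cong_def intro!: eq_matI)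
  then have "mat_mod m X \<in> unit_mats r m" "mat_mod q X \<in> unit_mats r q"
    using YZ by simp_all
  then have "mat_mod (m * q) X \<in> unit_mats r (m * q)"
    using assms X by (simp add: mat_mod_unit_mats_iff)
  moreover have "YZ = (mat_mod m (mat_mod (m * q) X), mat_mod q (mat_mod (m * q) X))"
    using YZ mq by (simp add: mat_mod_mod)
  ultimately show "YZ \<in> (\<lambda>X. (mat_mod m X, mat_mod q X)) ` unit_mats r (m * q)" by blast
qed

text \<open>Proportion of invertible matrices among all matrices modulo \<open>p\<close>. In this
  normalisation adjoining a prime \<open>q\<close> always contributes \<open>q ^ (r * r)\<close>,
  with an additional density factor only for a prime not seen before.\<close>

definition unit_density :: "nat \<Rightarrow> nat \<Rightarrow> complex" where
  "unit_density r p = of_nat (card (unit_mats r p)) / of_nat p ^ (r * r)"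

lemma sum_unit_mats_mult_dvd:
  fixes f :: "int mat \<Rightarrow> complex"
  assumes "m > 0" "q dvd m"
  shows "(\<Sum>X\<in>unit_mats r (m * q). f (mat_mod m X)) = of_nat q ^ (r * r) * (\<Sum>Y\<in>unit_mats r m. f Y)"
proof -
  have "(\<Sum>X\<in>unit_mats r (m * q). f (mat_mod m X)) =
    (\<Sum>(Y, Z)\<in>unit_mats r m \<times> residue_mats r q. f (mat_mod m (Y + int m \<cdot>\<^sub>m Z)))"
    by (subst sum.reindex_bij_betw[OF bij_betw_lift_dvd[OF assms], symmetric]) (simp add: case_prod_beta)
  also have "\<dots> = (\<Sum>(Y, Z)\<in>unit_mats r m \<times> residue_mats r q. f Y)"
  proof (intro sum.cong refl, clarify)
    fix Y Z assume "Y \<in> unit_mats r m" "Z \<in> residue_mats r q"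
    then have "mat_mod m (Y + int m \<cdot>\<^sub>m Z) = Y"
      by (intro eq_matI) (auto simp: unit_mats_def residue_mats_def)
    then show "f (mat_mod m (Y + int m \<cdot>\<^sub>m Z)) = f Y" by simp
  qed
  also have "\<dots> = of_nat q ^ (r * r) * (\<Sum>Y\<in>unit_mats r m. f Y)"
    by (simp add: sum.cartesian_product[symmetric] card_residue_mats sum_distrib_left)
  finally show ?thesis .
qed

lemma sum_unit_mats_mult_coprime:
  fixes f :: "int mat \<Rightarrow> complex"
  assumes "m > 0" "q > 0" "coprime m q"
  shows "(\<Sum>X\<in>unit_mats r (m * q). f (mat_mod m X)) =
    of_nat q ^ (r * r) * unit_density r q * (\<Sum>Y\<in>unit_mats r m. f Y)"
proof -
  have "(\<Sum>X\<in>unit_mats r (m * q). f (mat_mod m X)) = (\<Sum>(Y, Z)\<in>unit_mats r m \<times> unit_mats r q. f Y)"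
    by (subst sum.reindex_bij_betw[OF bij_betw_crt[OF assms], symmetric]) simp
  also have "\<dots> = of_nat (card (unit_mats r q)) * (\<Sum>Y\<in>unit_mats r m. f Y)"
    by (simp add: sum.cartesian_product[symmetric] sum_distrib_left)
  finally show ?thesis
    using assms by (simp add: unit_density_def)
qed

text \<open>Induction over the prime factors \<open>q\<close> of \<open>d\<close>. If
  \<open>q\<close> already divides the current modulus, all \<open>q ^ (r * r)\<close> lifts of an
  invertible matrix are invertible; otherwise the Chinese remainder theorem adds a free invertible
  matrix modulo \<open>q\<close>, and \<open>q\<close> joins the set of new primes.\<close>

lemma sum_unit_mats_lift:
  fixes f :: "int mat \<Rightarrow> complex"
  assumes "d > 0" "m > 0"
  shows "(\<Sum>X\<in>unit_mats r (d * m). f (mat_mod m X)) = of_nat d ^ (r * r) *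
    (\<Prod>p | prime p \<and> p dvd d * m \<and> \<not> p dvd m. unit_density r p) * (\<Sum>Y\<in>unit_mats r m. f Y)"
  using assms(1)
proof (induction d rule: prime_divisors_induct)
  case (unit x)
  then have "x = 1" by simp
  moreover have "f (mat_mod m X) = f X" if "X \<in> unit_mats r m" for X
    using that mat_mod_id[of X r m] by (simp add: unit_mats_def)
  ultimately show ?case by simp
next
  case (factor q x)
  then have "x > 0" "prime q" by auto
  define P where "P y = {p. prime p \<and> p dvd y * m \<and> \<not> p dvd m}" for y
  have fin: "finite (P x)"
    using \<open>x > 0\<close> assms(2) by (intro finite_subset[OF _ finite_divisors_nat[of "x * m"]]) (auto simp: P_def)
  have IH: "(\<Sum>X\<in>unit_mats r (x * m). f (mat_mod m X)) = of_nat x ^ (r * r) *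
    (\<Prod>p\<in>P x. unit_density r p) * (\<Sum>Y\<in>unit_mats r m. f Y)"
    using factor.IH \<open>x > 0\<close> by (simp add: P_def)
  \<comment> \<open>Reduction modulo \<open>m\<close> factors through modulus \<open>x * m\<close>,
    so a single prime is removed at a time.\<close>
  have step: "(\<Sum>X\<in>unit_mats r (q * x * m). f (mat_mod m X)) =
      (\<Sum>X\<in>unit_mats r (x * m * q). f (mat_mod m (mat_mod (x * m) X)))"
    by (simp add: mat_mod_mod mult_ac)
  show ?case
  proof (cases "q dvd x * m")
    case True
    then have "P (q * x) = P x"
      using \<open>prime q\<close> by (auto simp: P_def prime_dvd_mult_iff primes_dvd_imp_eq)
    then show ?thesis
      using sum_unit_mats_mult_dvd[where m = "x * m" and q = q and r = r and f = "\<lambda>X. f (mat_mod m X)"] True \<open>x > 0\<close> assms(2)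
      unfolding P_def[symmetric] step by (simp add: IH power_mult_distrib)
  next
    case False
    then have "P (q * x) = insert q (P x)" "q \<notin> P x"
      using \<open>prime q\<close> by (auto simp: P_def prime_dvd_mult_iff primes_dvd_imp_eq)
    moreover have "coprime (x * m) q"
      using False \<open>prime q\<close> by (metis coprime_commute prime_imp_coprime)
    ultimately show ?thesis
      using sum_unit_mats_mult_coprime[where m = "x * m" and q = q and r = r and f = "\<lambda>X. f (mat_mod m X)"] fin \<open>x > 0\<close> assms(2)
        prime_gt_0_nat[OF \<open>prime q\<close>]
      unfolding P_def[symmetric] step by (simp add: IH power_mult_distrib)
  qed
qed simp

section \<open>Fibres of the first column\<close>

text \<open>The shape of a matrix with zeros below its corner: \<open>x\<close> and the block
  \<open>Z\<close> decide determinant and trace, while the row \<open>w\<close> is free.\<close>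

definition corner_mat :: "nat \<Rightarrow> int \<Rightarrow> (nat \<Rightarrow> int) \<Rightarrow> int mat \<Rightarrow> int mat" where
  "corner_mat r x w Z =
     four_block_mat (mat 1 1 (\<lambda>_. x)) (mat 1 r (\<lambda>(_, j). w j)) (0\<^sub>m r 1) Z"

text \<open>\<open>c\<close> is a function on all naturals of which only the values below
  \<open>r\<close> matter, so columns can be given by plain lambda terms; see
  \<open>unit_fibre_cong\<close>.\<close>

definition unit_fibre :: "nat \<Rightarrow> nat \<Rightarrow> (nat \<Rightarrow> int) \<Rightarrow> int mat set" where
  "unit_fibre r n c = {X \<in> unit_mats r n. \<forall>i<r. X $$ (i, 0) = c i}"

lemma finite_unit_fibre [simp]: "finite (unit_fibre r n c)"
  by (simp add: unit_fibre_def)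

lemma corner_mat_carrier: "Z \<in> carrier_mat r r \<Longrightarrow> corner_mat r x w Z \<in> carrier_mat (Suc r) (Suc r)"
  by (auto simp: corner_mat_def)

lemma index_corner_mat:
  assumes "Z \<in> carrier_mat r r"
  shows "corner_mat r x w Z $$ (0, 0) = x"
    and "j < r \<Longrightarrow> corner_mat r x w Z $$ (0, Suc j) = w j"
    and "i < r \<Longrightarrow> corner_mat r x w Z $$ (Suc i, 0) = 0"
    and "i < r \<Longrightarrow> j < r \<Longrightarrow> corner_mat r x w Z $$ (Suc i, Suc j) = Z $$ (i, j)"
  using assms by (auto simp: corner_mat_def)

lemma det_corner_mat:
  assumes "Z \<in> carrier_mat r r"
  shows "det (corner_mat r x w Z) = x * det Z"
proof -
  have "det (corner_mat r x w Z) = det (mat 1 1 (\<lambda>_. x)) * det Z"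
    unfolding corner_mat_def by (rule det_four_block_mat_lower_left_zero[where m = r]) (use assms in auto)
  also have "det (mat 1 1 (\<lambda>_. x)) = x"
    by (subst det_single) auto
  finally show ?thesis .
qed

lemma mat_trace_corner_mat:
  assumes "Z \<in> carrier_mat r r"
  shows "mat_trace (corner_mat r x w Z) = x + mat_trace Z"
proof -
  have "dim_row (corner_mat r x w Z) = Suc r" "dim_row Z = r"
    using corner_mat_carrier[OF assms, of x w] assms by auto
  then show ?thesis
    by (simp add: mat_trace_def sum.lessThan_Suc_shift index_corner_mat[OF assms] del: sum.lessThan_Suc)
qed

lemma corner_mat_decomp:
  assumes "X \<in> carrier_mat (Suc r) (Suc r)" "\<forall>i<r. X $$ (Suc i, 0) = 0"
  shows "X = corner_mat r (X $$ (0, 0)) (restrict (\<lambda>j. X $$ (0, Suc j)) {..<r})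
    (mat r r (\<lambda>(i, j). X $$ (Suc i, Suc j)))" (is "X = ?R")
proof (intro eq_matI)
  define Z where "Z = mat r r (\<lambda>(i, j). X $$ (Suc i, Suc j))"
  have Z: "Z \<in> carrier_mat r r" by (simp add: Z_def)
  note C = corner_mat_carrier[OF Z, of "X $$ (0, 0)" "restrict (\<lambda>j. X $$ (0, Suc j)) {..<r}"]
  show "X $$ (i, j) = ?R $$ (i, j)" if "i < dim_row ?R" "j < dim_col ?R" for i j
  proof -
    have "i < Suc r" "j < Suc r"
      using that C unfolding Z_def by auto
    then show ?thesis
      unfolding Z_def[symmetric] using index_corner_mat[OF Z] assms(2)
      by (cases i; cases j) (simp_all add: Z_def)
  qed
  show "dim_row X = dim_row ?R" "dim_col X = dim_col ?R"
    using C assms(1) unfolding Z_def by auto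
qed

text \<open>The determinant is \<open>x * det Z\<close>, so for a unit \<open>x\<close> the matrix
  is invertible exactly when \<open>Z\<close> is, whatever the rest of the first row.\<close>

lemma bij_betw_corner_mat:
  assumes "coprime x (int n)" "0 \<le> x" "x < int n"
  shows "bij_betw (\<lambda>(w, Z). corner_mat r x w Z) (({..<r} \<rightarrow>\<^sub>E {0..<int n}) \<times> unit_mats r n)
    (unit_fibre (Suc r) n (\<lambda>i. if i = 0 then x else 0))"
proof (rule bij_betw_byWitness[where f' = "\<lambda>X. (restrict (\<lambda>j. X $$ (0, Suc j)) {..<r},
    mat r r (\<lambda>(i, j). X $$ (Suc i, Suc j)))"])
  show "\<forall>wZ\<in>({..<r} \<rightarrow>\<^sub>E {0..<int n}) \<times> unit_mats r n.
      (restrict (\<lambda>j. (case wZ of (w, Z) \<Rightarrow> corner_mat r x w Z) $$ (0, Suc j)) {..<r},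
       mat r r (\<lambda>(i, j). (case wZ of (w, Z) \<Rightarrow> corner_mat r x w Z) $$ (Suc i, Suc j))) = wZ"
  proof clarify
    fix w Z assume w: "w \<in> {..<r} \<rightarrow>\<^sub>E {0..<int n}" and "Z \<in> unit_mats r n"
    then have Z: "Z \<in> carrier_mat r r" by (simp add: unit_mats_carrier)
    have "restrict (\<lambda>j. corner_mat r x w Z $$ (0, Suc j)) {..<r} = restrict w {..<r}"
      by (intro restrict_ext) (simp add: index_corner_mat[OF Z])
    also have "\<dots> = w" using w by (rule PiE_restrict)
    finally show "restrict (\<lambda>j. corner_mat r x w Z $$ (0, Suc j)) {..<r} = w \<and>
        mat r r (\<lambda>(i, j). corner_mat r x w Z $$ (Suc i, Suc j)) = Z"
      using Z by (auto simp: index_corner_mat[OF Z] intro!: eq_matI)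
  qed
  have decomp: "X = corner_mat r x (restrict (\<lambda>j. X $$ (0, Suc j)) {..<r})
      (mat r r (\<lambda>(i, j). X $$ (Suc i, Suc j)))"
    if "X \<in> unit_fibre (Suc r) n (\<lambda>i. if i = 0 then x else 0)" for X
  proof -
    have "X \<in> carrier_mat (Suc r) (Suc r)" "\<forall>i<r. X $$ (Suc i, 0) = 0" "X $$ (0, 0) = x"
      using that by (auto simp: unit_fibre_def unit_mats_carrier)
    with corner_mat_decomp[of X r] show ?thesis by simp
  qed
  then show "\<forall>X\<in>unit_fibre (Suc r) n (\<lambda>i. if i = 0 then x else 0).
      (case (restrict (\<lambda>j. X $$ (0, Suc j)) {..<r}, mat r r (\<lambda>(i, j). X $$ (Suc i, Suc j))) of
        (w, Z) \<Rightarrow> corner_mat r x w Z) = X"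
    by (simp only: prod.case) metis
  show "(\<lambda>(w, Z). corner_mat r x w Z) ` (({..<r} \<rightarrow>\<^sub>E {0..<int n}) \<times> unit_mats r n)
      \<subseteq> unit_fibre (Suc r) n (\<lambda>i. if i = 0 then x else 0)"
  proof safe
    fix w Z assume w: "w \<in> {..<r} \<rightarrow>\<^sub>E {0..<int n}" and Z': "Z \<in> unit_mats r n"
    note Z = unit_mats_carrier[OF Z']
    have "corner_mat r x w Z $$ (i, j) \<in> {0..<int n}" if "i < Suc r" "j < Suc r" for i j
    proof -
      have "w j \<in> {0..<int n}" if "j < r" for j
        using PiE_mem[OF w, of j] that by simp
      moreover have "Z $$ (i, j) \<in> {0..<int n}" if "i < r" "j < r" for i j
        using Z' that unfolding unit_mats_def residue_mats_def by blast
      ultimately show ?thesis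
        using that assms index_corner_mat[OF Z] by (cases i; cases j) simp_all
    qed
    then have "corner_mat r x w Z \<in> residue_mats (Suc r) n"
      using corner_mat_carrier[OF Z] unfolding residue_mats_def by blast
    moreover have "coprime (det (corner_mat r x w Z)) (int n)"
      using Z' assms by (simp add: unit_mats_def det_corner_mat[OF Z])
    moreover have "corner_mat r x w Z $$ (i, 0) = (if i = 0 then x else 0)" if "i < Suc r" for i
      using that index_corner_mat[OF Z] by (cases i) simp_all
    ultimately show "corner_mat r x w Z \<in> unit_fibre (Suc r) n (\<lambda>i. if i = 0 then x else 0)"
      unfolding unit_fibre_def unit_mats_def by blast
  qed
  show "(\<lambda>X. (restrict (\<lambda>j. X $$ (0, Suc j)) {..<r}, mat r r (\<lambda>(i, j). X $$ (Suc i, Suc j)))) `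
      unit_fibre (Suc r) n (\<lambda>i. if i = 0 then x else 0)
      \<subseteq> ({..<r} \<rightarrow>\<^sub>E {0..<int n}) \<times> unit_mats r n"
  proof (rule image_subsetI, rule SigmaI)
    fix X assume X: "X \<in> unit_fibre (Suc r) n (\<lambda>i. if i = 0 then x else 0)"
    define Z where "Z = mat r r (\<lambda>(i, j). X $$ (Suc i, Suc j))"
    have Z: "Z \<in> carrier_mat r r" by (simp add: Z_def)
    have ran: "X $$ (i, j) \<in> {0..<int n}" if "i < Suc r" "j < Suc r" for i j
      using X that unfolding unit_fibre_def unit_mats_def residue_mats_def by blast
    then show "restrict (\<lambda>j. X $$ (0, Suc j)) {..<r} \<in> {..<r} \<rightarrow>\<^sub>E {0..<int n}"
      by (simp only: restrict_PiE_iff) simp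
    have "det X = x * det Z"
      using decomp[OF X] det_corner_mat[OF Z] unfolding Z_def by metis
    moreover have "coprime (det X) (int n)"
      using X by (simp add: unit_fibre_def unit_mats_def)
    ultimately show "mat r r (\<lambda>(i, j). X $$ (Suc i, Suc j)) \<in> unit_mats r n"
      using ran unfolding Z_def[symmetric] unit_mats_def residue_mats_def
      by (simp add: Z_def)
  qed
qed

text \<open>The trace is \<open>x + mat_trace Z\<close> and ignores the rest of the first row, whose
  \<open>n ^ r\<close> choices become a factor.\<close>

lemma sum_unit_fibre_corner:
  assumes "coprime x (int n)" "0 \<le> x" "x < int n"
  shows "(\<Sum>X\<in>unit_fibre (Suc r) n (\<lambda>i. if i = 0 then x else 0). f (mat_trace X)) =
    of_nat n ^ r * (\<Sum>Z\<in>unit_mats r n. f (x + mat_trace Z) :: complex)"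
proof -
  have "(\<Sum>X\<in>unit_fibre (Suc r) n (\<lambda>i. if i = 0 then x else 0). f (mat_trace X)) =
    (\<Sum>(w, Z)\<in>({..<r} \<rightarrow>\<^sub>E {0..<int n}) \<times> unit_mats r n. f (mat_trace (corner_mat r x w Z)))"
    by (subst sum.reindex_bij_betw[OF bij_betw_corner_mat[OF assms], symmetric]) (simp only: case_prod_unfold)
  also have "\<dots> = (\<Sum>(w, Z)\<in>({..<r} \<rightarrow>\<^sub>E {0..<int n}) \<times> unit_mats r n. f (x + mat_trace Z))"
  proof (intro sum.cong refl, clarify)
    fix w Z assume "Z \<in> unit_mats r n"
    from mat_trace_corner_mat[OF unit_mats_carrier[OF this]]
    show "f (mat_trace (corner_mat r x w Z)) = f (x + mat_trace Z)" by simp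
  qed
  also have "\<dots> = of_nat n ^ r * (\<Sum>Z\<in>unit_mats r n. f (x + mat_trace Z))"
    by (simp add: sum.cartesian_product[symmetric] card_PiE)
  finally show ?thesis .
qed

text \<open>By block triangularity \<open>x\<close> divides the determinant, which would have to be
  coprime to \<open>n\<close>.\<close>

lemma unit_fibre_corner_empty:
  assumes "\<not> coprime x (int n)"
  shows "unit_fibre (Suc r) n (\<lambda>i. if i = 0 then x else 0) = {}"
proof (rule ccontr)
  assume "unit_fibre (Suc r) n (\<lambda>i. if i = 0 then x else 0) \<noteq> {}"
  then obtain X where X: "X \<in> unit_fibre (Suc r) n (\<lambda>i. if i = 0 then x else 0)" by blast
  define Z where "Z = mat r r (\<lambda>(i, j). X $$ (Suc i, Suc j))"
  have Z: "Z \<in> carrier_mat r r" by (simp add: Z_def)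
  have "X \<in> carrier_mat (Suc r) (Suc r)" "\<forall>i<r. X $$ (Suc i, 0) = 0" "X $$ (0, 0) = x"
    using X by (auto simp: unit_fibre_def unit_mats_carrier)
  then have "det X = x * det Z"
    using corner_mat_decomp[of X r] det_corner_mat[OF Z] unfolding Z_def by metis
  with X assms show False
    by (simp add: unit_fibre_def unit_mats_def)
qed

text \<open>Adding a multiple of column 0 to a later column preserves the determinant and column 0;
  the opposite multiple undoes it.\<close>

lemma bij_betw_addcol:
  assumes "n > 0" "0 < k" "k < r"
  shows "bij_betw (\<lambda>X. mat_mod n (addcol a k 0 X)) (unit_fibre r n c) (unit_fibre r n c)"
proof -
  have car: "addcol a k 0 X \<in> carrier_mat r r" if "X \<in> carrier_mat r r" for X :: "int mat" and a
    using that by (intro carrier_matI) auto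
  have maps: "mat_mod n (addcol a k 0 X) \<in> unit_fibre r n c" if "X \<in> unit_fibre r n c" for X a
  proof -
    have X: "X \<in> unit_mats r n" and c: "\<forall>i<r. X $$ (i, 0) = c i"
      using that by (simp_all add: unit_fibre_def)
    note C = unit_mats_carrier[OF X]
    have "det (addcol a k 0 X) = det X"
      using assms C by (intro det_addcol[of 0 r]) auto
    then have "mat_mod n (addcol a k 0 X) \<in> unit_mats r n"
      using X mat_mod_unit_mats_iff[OF assms(1) car[OF C]] by (simp add: unit_mats_def)
    moreover have "mat_mod n (addcol a k 0 X) $$ (i, 0) = c i" if "i < r" for i
    proof -
      have "X $$ (i, 0) \<in> {0..<int n}"
        using X that assms unfolding unit_mats_def residue_mats_def by force
      then show ?thesis
        using C c that assms by simp
    qed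
    ultimately show ?thesis by (simp add: unit_fibre_def)
  qed
  have inv: "mat_mod n (addcol (- a) k 0 (mat_mod n (addcol a k 0 X))) = X"
    if "X \<in> unit_fibre r n c" for X a
  proof -
    have "X \<in> residue_mats r n"
      using that by (simp add: unit_fibre_def unit_mats_def)
    note R = this residue_mats_carrier[OF this]
    have "X $$ (i, j) mod int n = X $$ (i, j)" if "i < r" "j < r" for i j
      using R(1) that by (simp add: residue_mats_def)
    then show ?thesis
      using R(2) assms by (intro eq_matI) (auto simp: mod_simps)
  qed
  show ?thesis
    by (rule bij_betw_byWitness[where f' = "\<lambda>X. mat_mod n (addcol (- a) k 0 X)"])
      (use maps inv[of _ a] inv[of _ "- a"] in auto)
qed

text \<open>The row operation preserves the determinant but also acts on the first column, so it
  carries one fibre to another.\<close>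

lemma bij_betw_addrow:
  assumes "n > 0" "k < r" "l < r" "k \<noteq> l" "0 \<le> c k" "c k < int n"
  shows "bij_betw (\<lambda>X. mat_mod n (addrow a k l X)) (unit_fibre r n c)
    (unit_fibre r n (c(k := (a * c l + c k) mod int n)))"
proof -
  have car: "addrow a k l X \<in> carrier_mat r r" if "X \<in> carrier_mat r r" for X :: "int mat" and a
    using that by simp
  have maps: "mat_mod n (addrow a k l X) \<in> unit_fibre r n (c(k := (a * c l + c k) mod int n))"
    if "X \<in> unit_fibre r n c" for X a c
  proof -
    have X: "X \<in> unit_mats r n" and c: "\<forall>i<r. X $$ (i, 0) = c i"
      using that by (simp_all add: unit_fibre_def)
    note C = unit_mats_carrier[OF X]
    have "det (addrow a k l X) = det X"
      using assms C by (intro det_addrow[of l r]) auto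
    then have "mat_mod n (addrow a k l X) \<in> unit_mats r n"
      using X mat_mod_unit_mats_iff[OF assms(1) car[OF C]] by (simp add: unit_mats_def)
    moreover have "mat_mod n (addrow a k l X) $$ (i, 0) = (c(k := (a * c l + c k) mod int n)) i"
      if "i < r" for i
    proof -
      have "X $$ (i, 0) \<in> {0..<int n}"
        using X that assms unfolding unit_mats_def residue_mats_def by force
      then show ?thesis
        using C c that assms by simp
    qed
    ultimately show ?thesis by (simp add: unit_fibre_def)
  qed
  have inv: "mat_mod n (addrow (- a) k l (mat_mod n (addrow a k l X))) = X"
    if "X \<in> unit_fibre r n c" for X a c
  proof -
    have "X \<in> residue_mats r n"
      using that by (simp add: unit_fibre_def unit_mats_def)
    note R = this residue_mats_carrier[OF this]
    have "X $$ (i, j) mod int n = X $$ (i, j)" if "i < r" "j < r" for i j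
      using R(1) that by (simp add: residue_mats_def)
    then show ?thesis
      using R(2) assms by (intro eq_matI) (auto simp: mod_simps)
  qed
  define c' where "c' = c(k := (a * c l + c k) mod int n)"
  \<comment> \<open>The range condition on \<open>c k\<close> makes the return to \<open>c\<close>
    an equality rather than a congruence.\<close>
  have "c'(k := (- a * c' l + c' k) mod int n) = c"
    using assms by (auto simp: c'_def mod_simps)
  then have "mat_mod n (addrow (- a) k l X) \<in> unit_fibre r n c" if "X \<in> unit_fibre r n c'" for X
    using maps[OF that, of "- a"] by simp
  then show ?thesis
    unfolding c'_def[symmetric]
    by (intro bij_betw_byWitness[where f' = "\<lambda>X. mat_mod n (addrow (- a) k l X)"])
      (use maps[of _ c a] inv[of _ c a] inv[of _ c' "- a"] in \<open>auto simp: c'_def\<close>)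
qed

lemma unit_fibre_cong: "(\<And>i. i < r \<Longrightarrow> c i = c' i) \<Longrightarrow> unit_fibre r n c = unit_fibre r n c'"
  by (simp add: unit_fibre_def)

lemma sum_unit_mats_fibres:
  fixes f :: "int mat \<Rightarrow> complex"
  assumes "r > 0"
  shows "(\<Sum>X\<in>unit_mats r n. f X) = (\<Sum>c\<in>{..<r} \<rightarrow>\<^sub>E {0..<int n}. \<Sum>X\<in>unit_fibre r n c. f X)"
proof -
  define g where "g X = restrict (\<lambda>i. X $$ (i, 0 :: nat)) {..<r}" for X :: "int mat"
  have "X $$ (i, 0) \<in> {0..<int n}" if "X \<in> unit_mats r n" "i < r" for X i
    using that assms unfolding unit_mats_def residue_mats_def by blast
  then have "g ` unit_mats r n \<subseteq> {..<r} \<rightarrow>\<^sub>E {0..<int n}"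
    unfolding g_def by (intro image_subsetI) (simp only: restrict_PiE_iff lessThan_iff Ball_def, simp)
  then have "(\<Sum>X\<in>unit_mats r n. f X) =
      (\<Sum>c\<in>{..<r} \<rightarrow>\<^sub>E {0..<int n}. \<Sum>X\<in>{X \<in> unit_mats r n. g X = c}. f X)"
    by (intro sum.group[symmetric]) (auto simp: finite_PiE)
  also have "\<dots> = (\<Sum>c\<in>{..<r} \<rightarrow>\<^sub>E {0..<int n}. \<Sum>X\<in>unit_fibre r n c. f X)"
  proof (intro sum.cong refl)
    fix c assume c: "c \<in> {..<r} \<rightarrow>\<^sub>E {0..<int n}"
    have "g X = c \<longleftrightarrow> (\<forall>i<r. X $$ (i, 0) = c i)" for X
    proof -
      have "g X = c \<longleftrightarrow> g X = restrict c {..<r}"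
        using PiE_restrict[OF c] by simp
      also have "\<dots> \<longleftrightarrow> (\<forall>i<r. X $$ (i, 0) = c i)"
        by (auto simp: g_def restrict_def fun_eq_iff)
      finally show ?thesis .
    qed
    then show "{X \<in> unit_mats r n. g X = c} = unit_fibre r n c"
      by (simp add: unit_fibre_def)
  qed
  finally show ?thesis .
qed

section \<open>Trace character sums\<close>

text \<open>The sum \<open>S(k)\<close> of the overview, with size and modulus as parameters:
  peeling off a column lowers \<open>r\<close>, and reduction changes \<open>n\<close>.\<close>

definition trace_char_sum :: "nat \<Rightarrow> nat \<Rightarrow> int \<Rightarrow> complex" where
  "trace_char_sum r n u = (\<Sum>X\<in>unit_mats r n. echar n (u * mat_trace X))"

text \<open>Totatives lie in \<open>{1..n}\<close> and residues in \<open>{0..<n}\<close>, so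
  \<open>n\<close> has to be exchanged with 0. This occurs only for \<open>n = 1\<close>.\<close>

lemma bij_betw_totatives_residues:
  assumes "n > 0"
  shows "bij_betw (\<lambda>j. int j mod int n) (totatives n) {x \<in> {0..<int n}. coprime x (int n)}"
proof (rule bij_betw_byWitness[where f' = "\<lambda>x. if x = 0 then n else nat x"])
  show "\<forall>j\<in>totatives n. (if int j mod int n = 0 then n else nat (int j mod int n)) = j"
  proof
    fix j assume "j \<in> totatives n"
    then have "0 < j" "j \<le> n" by (simp_all add: in_totatives_iff)
    then show "(if int j mod int n = 0 then n else nat (int j mod int n)) = j"
      by (cases "j = n") simp_all
  qed
  show "\<forall>x\<in>{x \<in> {0..<int n}. coprime x (int n)}. int (if x = 0 then n else nat x) mod int n = x"
    by simp
  show "(\<lambda>j. int j mod int n) ` totatives n \<subseteq> {x \<in> {0..<int n}. coprime x (int n)}"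
    using assms by (auto simp: in_totatives_iff)
  show "(\<lambda>x. if x = 0 then n else nat x) ` {x \<in> {0..<int n}. coprime x (int n)} \<subseteq> totatives n"
  proof (rule image_subsetI)
    fix x assume x: "x \<in> {x \<in> {0..<int n}. coprime x (int n)}"
    then have "coprime (nat x) n" if "x \<noteq> 0"
      using coprime_int_iff[of "nat x" n] by simp
    moreover have "n = 1" if "x = 0"
      using x that by simp
    ultimately show "(if x = 0 then n else nat x) \<in> totatives n"
      using x by (auto simp: in_totatives_iff)
  qed
qed

lemma ramanujan_sum_residues:
  assumes "n > 0"
  shows "ramanujan_sum n k = (\<Sum>x | x \<in> {0..<int n} \<and> coprime x (int n). echar n (k * x))"
proof -
  have "echar n (k * (int j mod int n)) = echar n (int j * k)" for j
    using assms by (intro echar_cong) (simp_all add: cong_def mod_mult_right_eq mult.commute)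
  then show ?thesis
    by (subst sum.reindex_bij_betw[OF bij_betw_totatives_residues[OF assms], symmetric])
      (simp add: ramanujan_sum_echar)
qed

text \<open>Multiplication by a unit permutes the unit residues.\<close>

lemma ramanujan_sum_mult_coprime:
  assumes "n > 0" "coprime u (int n)"
  shows "ramanujan_sum n (u * k) = ramanujan_sum n k"
proof -
  define R where "R = {x. x \<in> {0..<int n} \<and> coprime x (int n)}"
  have fin: "finite R"
    unfolding R_def by (rule finite_subset[of _ "{0..<int n}"]) auto
  have "inj_on (\<lambda>x. u * x mod int n) R"
  proof (rule inj_onI)
    fix x y assume "x \<in> R" "y \<in> R" "u * x mod int n = u * y mod int n"
    then have "[x = y] (mod int n)"
      using assms(2) cong_mult_lcancel[of u "int n" x y] by (simp add: cong_def)
    with \<open>x \<in> R\<close> \<open>y \<in> R\<close> show "x = y" by (simp add: R_def cong_def)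
  qed
  moreover have "(\<lambda>x. u * x mod int n) ` R \<subseteq> R"
    using assms by (auto simp: R_def)
  ultimately have "bij_betw (\<lambda>x. u * x mod int n) R R"
    using endo_inj_surj[OF fin] by (simp add: bij_betw_def)
  then have "ramanujan_sum n k = (\<Sum>x\<in>R. echar n (k * (u * x mod int n)))"
    by (subst sum.reindex_bij_betw) (simp_all add: ramanujan_sum_residues[OF assms(1)] R_def)
  also have "\<dots> = (\<Sum>x\<in>R. echar n (u * k * x))"
    using assms(1) by (intro sum.cong refl echar_cong) (simp_all add: cong_def mod_mult_right_eq mult_ac)
  also have "\<dots> = ramanujan_sum n (u * k)"
    by (simp add: ramanujan_sum_residues[OF assms(1)] R_def)
  finally show ?thesis ..
qed

text \<open>Adding column 0 to column \<open>k\<close> permutes the fibre and shifts the trace by \<open>c k\<close>, so the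
  fibre sum is multiplied by a nontrivial root of unity.\<close>

lemma sum_echar_trace_fibre_eq_0:
  assumes "coprime u (int n)" "0 < k" "k < r" "0 < c k" "c k < int n"
  shows "(\<Sum>X\<in>unit_fibre r n c. echar n (u * mat_trace X)) = 0"
proof -
  define F where "F = (\<Sum>X\<in>unit_fibre r n c. echar n (u * mat_trace X))"
  have n: "n > 0" using assms by linarith
  have "F = (\<Sum>X\<in>unit_fibre r n c. echar n (u * mat_trace (mat_mod n (addcol 1 k 0 X))))"
    unfolding F_def using bij_betw_addcol[OF n assms(2,3), of 1 c]
    by (rule sum.reindex_bij_betw[symmetric])
  also have "\<dots> = (\<Sum>X\<in>unit_fibre r n c. echar n (u * c k) * echar n (u * mat_trace X))"
  proof (intro sum.cong refl)
    fix X assume X: "X \<in> unit_fibre r n c"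
    then have C: "X \<in> carrier_mat r r" and ck: "X $$ (k, 0) = c k"
      using assms by (auto simp: unit_fibre_def unit_mats_carrier)
    have "mat_trace (addcol 1 k 0 X) = (\<Sum>i<r. X $$ (i, i) + (if i = k then X $$ (k, 0) else 0))"
      using C by (auto simp: mat_trace_def intro!: sum.cong)
    also have "\<dots> = mat_trace X + c k"
      using C assms(3) ck by (simp add: mat_trace_def sum.distrib)
    finally have tr: "mat_trace (addcol 1 k 0 X) = mat_trace X + c k" .
    have "[mat_trace (mat_mod n (addcol 1 k 0 X)) = mat_trace (addcol 1 k 0 X)] (mod int n)"
      by (rule cong_mat_trace_mat_mod[of _ r]) (use C in \<open>intro carrier_matI, auto\<close>)
    then have "echar n (u * mat_trace (mat_mod n (addcol 1 k 0 X))) = echar n (u * (mat_trace X + c k))"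
      unfolding tr by (intro echar_cong[OF n] cong_mult[OF cong_refl])
    then show "echar n (u * mat_trace (mat_mod n (addcol 1 k 0 X))) =
        echar n (u * c k) * echar n (u * mat_trace X)"
      by (simp add: ring_distribs echar_add)
  qed
  also have "\<dots> = echar n (u * c k) * F"
    by (simp add: F_def sum_distrib_left)
  finally have "F = echar n (u * c k) * F" .
  moreover have "echar n (u * c k) \<noteq> 1"
  proof
    assume "echar n (u * c k) = 1"
    then have "int n dvd c k"
      using n assms(1) by (simp add: echar_eq_1_iff coprime_dvd_mult_right_iff coprime_commute)
    with assms show False
      using zdvd_not_zless by blast
  qed
  ultimately show ?thesis unfolding F_def by (metis mult_cancel_right1)
qed

text \<open>Split by the first column. A nonzero entry below the corner makes the fibre sum vanish;
  for \<open>(x, 0, ..., 0)\<close> the fibre is empty unless \<open>x\<close> is a unit, and then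
  it contributes \<open>echar n (u * x)\<close> times \<open>n ^ r\<close> times the sum of size
  \<open>r\<close>. The alternative \<open>r = 0\<close> admits every \<open>u\<close>, as a single
  entry has nothing below it; \<open>trace_char_sum_1\<close> relies on this.\<close>

lemma trace_char_sum_Suc:
  assumes "n > 0" "r = 0 \<or> coprime u (int n)"
  shows "trace_char_sum (Suc r) n u = of_nat n ^ r * ramanujan_sum n u * trace_char_sum r n u"
proof -
  define S where "S = {..<Suc r} \<rightarrow>\<^sub>E {0..<int n}"
  \<comment> \<open>The restriction makes \<open>col x\<close> a member of the extensional function
    space \<open>S\<close>.\<close>
  define col where "col x = restrict (\<lambda>i. if i = 0 then x else 0) {..<Suc r}" for x :: int
  define F where "F c = (\<Sum>X\<in>unit_fibre (Suc r) n c. echar n (u * mat_trace X))" for c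
  have F_col: "F (col x) = F (\<lambda>i. if i = 0 then x else 0)" for x
    unfolding F_def by (intro sum.cong unit_fibre_cong) (auto simp: col_def)
  have "col ` {0..<int n} \<subseteq> S"
    by (auto simp: col_def S_def split: if_splits)
  moreover have "F c = 0" if c: "c \<in> S - col ` {0..<int n}" for c
  proof (cases "\<exists>k. 0 < k \<and> k < Suc r \<and> c k \<noteq> 0")
    case True
    then obtain k where k: "0 < k" "k < Suc r" "c k \<noteq> 0" by blast
    then have "c k \<in> {0..<int n}"
      using c PiE_mem[of c "{..<Suc r}" "\<lambda>_. {0..<int n}" k] by (simp add: S_def)
    \<comment> \<open>Such a \<open>k\<close> forces \<open>r > 0\<close>, which leaves the coprime
      alternative of the hypothesis.\<close>
    then show ?thesis
      unfolding F_def using assms k by (intro sum_echar_trace_fibre_eq_0[of u n k]) auto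
  next
    case False
    then have "restrict c {..<Suc r} = col (c 0)"
      unfolding col_def by (intro restrict_ext) auto
    moreover have "restrict c {..<Suc r} = c"
      using c by (intro PiE_restrict[of _ _ "\<lambda>_. {0..<int n}"]) (simp add: S_def)
    moreover have "c 0 \<in> {0..<int n}"
      using c PiE_mem[of c "{..<Suc r}" "\<lambda>_. {0..<int n}" 0] by (simp add: S_def)
    ultimately show ?thesis using c by (metis DiffE imageI)
  qed
  moreover have "finite S" by (simp add: S_def finite_PiE)
  ultimately have "(\<Sum>c\<in>S. F c) = (\<Sum>c\<in>col ` {0..<int n}. F c)"
    by (intro sum.mono_neutral_right) auto
  also have "inj_on col {0..<int n}"
  proof (rule inj_onI)
    fix x y assume "col x = col y"
    then have "col x 0 = col y 0" by simp
    then show "x = y" by (simp add: col_def)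
  qed
  then have "(\<Sum>c\<in>col ` {0..<int n}. F c) = (\<Sum>x\<in>{0..<int n}. F (\<lambda>i. if i = 0 then x else 0))"
    by (simp add: sum.reindex F_col)
  also have "\<dots> = (\<Sum>x | x \<in> {0..<int n} \<and> coprime x (int n). F (\<lambda>i. if i = 0 then x else 0))"
    by (intro sum.mono_neutral_right) (auto simp: F_def unit_fibre_corner_empty)
  also have "\<dots> = (\<Sum>x | x \<in> {0..<int n} \<and> coprime x (int n).
      echar n (u * x) * (of_nat n ^ r * trace_char_sum r n u))"
  proof (intro sum.cong refl)
    fix x assume "x \<in> {x. x \<in> {0..<int n} \<and> coprime x (int n)}"
    then have "F (\<lambda>i. if i = 0 then x else 0) =
        of_nat n ^ r * (\<Sum>Z\<in>unit_mats r n. echar n (u * (x + mat_trace Z)))"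
      unfolding F_def by (intro sum_unit_fibre_corner) auto
    also have "(\<Sum>Z\<in>unit_mats r n. echar n (u * (x + mat_trace Z))) =
        echar n (u * x) * trace_char_sum r n u"
      by (simp add: trace_char_sum_def ring_distribs echar_add sum_distrib_left)
    finally show "F (\<lambda>i. if i = 0 then x else 0) =
        echar n (u * x) * (of_nat n ^ r * trace_char_sum r n u)" by simp
  qed
  also have "\<dots> = of_nat n ^ r * ramanujan_sum n u * trace_char_sum r n u"
    by (simp add: ramanujan_sum_residues[OF assms(1)] sum_distrib_right[symmetric])
  finally show ?thesis
    unfolding trace_char_sum_def[of "Suc r"] S_def F_def by (subst sum_unit_mats_fibres) simp_all
qed

lemma unit_mats_0: "card (unit_mats 0 n) = 1"
proof -
  have "unit_mats 0 n = residue_mats 0 n"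
    by (auto simp: unit_mats_def residue_mats_def)
  then show ?thesis by (simp add: card_residue_mats)
qed

lemma trace_char_sum_0: "trace_char_sum 0 n u = 1"
proof -
  have "mat_trace X = 0" if "X \<in> unit_mats 0 n" for X
    using unit_mats_carrier[OF that] by (simp add: mat_trace_def)
  then show ?thesis by (simp add: trace_char_sum_def unit_mats_0)
qed

lemma trace_char_sum_1: "n > 0 \<Longrightarrow> trace_char_sum 1 n k = ramanujan_sum n k"
  by (simp add: trace_char_sum_Suc trace_char_sum_0)

lemma triangular_Suc: "Suc r * r div 2 = r + r * (r - 1) div 2"
  using div_mult_self2[of 2 "r * (r - 1)" r] by (cases r) (simp_all add: algebra_simps)

text \<open>Each peeling step contributes a power of \<open>n\<close> and a Ramanujan sum; the
  exponents add up to a triangular number, and the unit \<open>u\<close> drops out of the Ramanujan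
  sum.\<close>

lemma trace_char_sum_coprime:
  assumes "n > 0" "coprime u (int n)"
  shows "trace_char_sum r n u = of_nat n ^ (r * (r - 1) div 2) * ramanujan_sum n 1 ^ r"
proof (induction r)
  case (Suc r)
  have "ramanujan_sum n u = ramanujan_sum n 1"
    using ramanujan_sum_mult_coprime[OF assms, of 1] by simp
  with Suc show ?case
    using assms triangular_Suc[of r] by (simp add: trace_char_sum_Suc power_add)
qed (simp add: trace_char_sum_0)

section \<open>Counting over prime fields\<close>

text \<open>Modulo a prime the nonzero entry \<open>c l\<close> is invertible, so adding a multiple
  of row \<open>l\<close> to row \<open>k\<close> turns \<open>c k\<close> into any prescribed
  \<open>v\<close>.\<close>

lemma card_unit_fibre_update:
  assumes "prime p" "k < r" "l < r" "k \<noteq> l" "c k \<in> {0..<int p}" "c l \<in> {0<..<int p}" "v \<in> {0..<int p}"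
  shows "card (unit_fibre r p c) = card (unit_fibre r p (c(k := v)))"
proof -
  have p: "p > 0" using assms(1) by (rule prime_gt_0_nat)
  have "\<not> int p dvd c l"
    using assms(6) zdvd_not_zless by fastforce
  then have "coprime (c l) (int p)"
    using assms(1) by (simp add: coprime_commute prime_imp_coprime)
  \<comment> \<open>With \<open>b\<close> inverse to \<open>c l\<close>, the multiplier of row
    \<open>l\<close> is \<open>b * (v - c k)\<close>.\<close>
  then obtain b where "[c l * b = 1] (mod int p)"
    using coprime_iff_invertible_int by blast
  then have "[c l * b * (v - c k) + c k = 1 * (v - c k) + c k] (mod int p)"
    by (intro cong_add cong_mult cong_refl)
  then have "(b * (v - c k) * c l + c k) mod int p = v"
    using assms(7) by (simp add: cong_def mult_ac)
  then show ?thesis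
    using bij_betw_same_card[OF bij_betw_addrow[OF p assms(2,3,4), of c "b * (v - c k)"]] assms(5)
    by simp
qed

text \<open>The nonzero head serves as pivot: the other entries of the column are cleared one at a
  time without changing the count, and a corner column remains.\<close>

lemma card_unit_fibre_head:
  assumes "prime p" "\<And>i. i < Suc r \<Longrightarrow> c i \<in> {0..<int p}" "c 0 \<noteq> 0"
  shows "card (unit_fibre (Suc r) p c) = p ^ r * card (unit_mats r p)"
proof -
  have c0: "c 0 \<in> {0<..<int p}"
    using assms(2)[of 0] assms(3) by auto
  \<comment> \<open>\<open>K\<close> is the set of positions cleared so far.\<close>
  have "card (unit_fibre (Suc r) p c) = card (unit_fibre (Suc r) p (\<lambda>i. if i \<in> K then 0 else c i))"
    if "finite K" "K \<subseteq> {0<..<Suc r}" for K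
    using that
  proof (induction K rule: finite_induct)
    case (insert k K)
    define c' where "c' = (\<lambda>i. if i \<in> K then 0 else c i)"
    have "card (unit_fibre (Suc r) p c) = card (unit_fibre (Suc r) p c')"
      using insert by (simp add: c'_def)
    also have "\<dots> = card (unit_fibre (Suc r) p (c'(k := 0)))"
      using assms(1,2) c0 insert.prems insert.hyps prime_gt_0_nat[OF assms(1)]
      by (intro card_unit_fibre_update[where l = 0]) (auto simp: c'_def)
    also have "c'(k := 0) = (\<lambda>i. if i \<in> insert k K then 0 else c i)"
      by (auto simp: c'_def fun_eq_iff)
    finally show ?case .
  qed simp
  from this[of "{0<..<Suc r}"] have "card (unit_fibre (Suc r) p c) =
      card (unit_fibre (Suc r) p (\<lambda>i. if i \<in> {0<..<Suc r} then 0 else c i))"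
    by blast
  also have "unit_fibre (Suc r) p (\<lambda>i. if i \<in> {0<..<Suc r} then 0 else c i) =
      unit_fibre (Suc r) p (\<lambda>i. if i = 0 then c 0 else 0)"
    by (intro unit_fibre_cong) auto
  finally have *: "card (unit_fibre (Suc r) p c) = card (unit_fibre (Suc r) p (\<lambda>i. if i = 0 then c 0 else 0))" .
  have "\<not> int p dvd c 0"
    using c0 zdvd_not_zless by fastforce
  then have "coprime (c 0) (int p)"
    using assms(1) by (simp add: coprime_commute prime_imp_coprime)
  \<comment> \<open>The count is the corner sum of the constant function 1; since that sum is
    complex-valued, the equality passes through the embedding of the naturals.\<close>
  then have "complex_of_nat (card (unit_fibre (Suc r) p (\<lambda>i. if i = 0 then c 0 else 0))) =
      complex_of_nat (p ^ r * card (unit_mats r p))"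
    using c0 sum_unit_fibre_corner[where x = "c 0" and n = p and r = r and f = "\<lambda>_. 1"] by simp
  then show ?thesis
    unfolding * by (simp only: of_nat_eq_iff)
qed

text \<open>A zero head is first turned into 1 with the help of row \<open>l\<close>.\<close>

lemma card_unit_fibre_nonzero:
  assumes "prime p" "\<And>i. i < Suc r \<Longrightarrow> c i \<in> {0..<int p}" "l < Suc r" "c l \<noteq> 0"
  shows "card (unit_fibre (Suc r) p c) = p ^ r * card (unit_mats r p)"
proof (cases "c 0 = 0")
  case False
  then show ?thesis using assms by (intro card_unit_fibre_head) auto
next
  case True
  with assms have "l \<noteq> 0" by metis
  have "c l \<in> {0<..<int p}"
    using assms(2)[OF assms(3)] assms(4) by auto
  moreover have "1 \<in> {0..<int p}"
    using prime_gt_1_nat[OF assms(1)] by simp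
  ultimately have "card (unit_fibre (Suc r) p c) = card (unit_fibre (Suc r) p (c(0 := 1)))"
    using \<open>l \<noteq> 0\<close> assms(1,3) assms(2)[of 0]
    by (intro card_unit_fibre_update[where l = l]) simp_all
  also have "\<dots> = p ^ r * card (unit_mats r p)"
    using assms(1,2) prime_gt_1_nat[OF assms(1)] by (intro card_unit_fibre_head) auto
  finally show ?thesis .
qed

text \<open>Each of the \<open>p ^ Suc r - 1\<close> nonzero first columns has the same number of
  completions, and the zero column has none.\<close>

lemma card_unit_mats_Suc:
  assumes "prime p"
  shows "complex_of_nat (card (unit_mats (Suc r) p)) =
    (of_nat p ^ Suc r - 1) * of_nat p ^ r * of_nat (card (unit_mats r p))"
proof -
  define S where "S = {..<Suc r} \<rightarrow>\<^sub>E {0..<int p}"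
  define z where "z = restrict (\<lambda>_. 0 :: int) {..<Suc r}"
  have p: "p > 0" using assms by (rule prime_gt_0_nat)
  have "z \<in> S" using p by (simp add: z_def S_def restrict_PiE_iff)
  have "finite S" by (simp add: S_def finite_PiE)
  have "card S = p ^ Suc r" by (simp add: S_def card_PiE)
  \<comment> \<open>The zero column is a corner column with \<open>x = 0\<close>, which is not
    coprime to \<open>p\<close>.\<close>
  have "unit_fibre (Suc r) p z = unit_fibre (Suc r) p (\<lambda>i. if i = 0 then 0 else 0)"
    by (intro unit_fibre_cong) (simp add: z_def)
  also have "\<dots> = {}"
    using prime_gt_1_nat[OF assms] by (intro unit_fibre_corner_empty) simp
  finally have z0: "unit_fibre (Suc r) p z = {}" .
  have ne: "card (unit_fibre (Suc r) p c) = p ^ r * card (unit_mats r p)" if "c \<in> S - {z}" for c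
  proof -
    have "restrict c {..<Suc r} = c"
      using that by (intro PiE_restrict[of _ _ "\<lambda>_. {0..<int p}"]) (simp add: S_def)
    moreover have "restrict c {..<Suc r} = z" if "\<forall>l<Suc r. c l = 0"
      unfolding z_def using that by (intro restrict_ext) simp
    ultimately obtain l where "l < Suc r" "c l \<noteq> 0"
      using \<open>c \<in> S - {z}\<close> by force
    moreover have "c i \<in> {0..<int p}" if "i < Suc r" for i
      using \<open>c \<in> S - {z}\<close> that PiE_mem[of c "{..<Suc r}" "\<lambda>_. {0..<int p}" i] by (simp add: S_def)
    ultimately show ?thesis
      using assms by (intro card_unit_fibre_nonzero)
  qed
  have "complex_of_nat (card (unit_mats (Suc r) p)) = (\<Sum>c\<in>S. of_nat (card (unit_fibre (Suc r) p c)))"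
    using sum_unit_mats_fibres[of "Suc r" "\<lambda>_. 1" p] by (simp add: S_def)
  also have "\<dots> = (\<Sum>c\<in>S - {z}. of_nat (card (unit_fibre (Suc r) p c)))"
    using sum.remove[OF \<open>finite S\<close> \<open>z \<in> S\<close>, of "\<lambda>c. complex_of_nat (card (unit_fibre (Suc r) p c))"] z0
    by simp
  also have "\<dots> = (\<Sum>c\<in>S - {z}. of_nat (p ^ r * card (unit_mats r p)))"
    using ne by (intro sum.cong refl) simp
  also have "\<dots> = of_nat (p ^ Suc r - 1) * of_nat (p ^ r * card (unit_mats r p))"
    using \<open>z \<in> S\<close> \<open>finite S\<close> \<open>card S = p ^ Suc r\<close> by simp
  also have "complex_of_nat (p ^ Suc r - 1) = of_nat p ^ Suc r - 1"
    using p by (subst of_nat_diff) simp_all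
  finally show ?thesis by simp
qed

lemma unit_density_prime:
  assumes "prime p"
  shows "unit_density r p = (\<Prod>i = 1..r. 1 - of_nat p powi (- int i))"
proof (induction r)
  case 0
  then show ?case by (simp add: unit_density_def unit_mats_0)
next
  case (Suc r)
  define P where "P = complex_of_nat p"
  have P: "P \<noteq> 0"
    using prime_gt_0_nat[OF assms] by (simp add: P_def)
  \<comment> \<open>This splitting of the exponent matches the three factors of the count; the first
    quotient leaves \<open>1 - 1 / P ^ Suc r\<close>.\<close>
  have "Suc r * Suc r = Suc r + r + r * r" by simp
  then have "unit_density (Suc r) p = (P ^ Suc r - 1) * P ^ r * of_nat (card (unit_mats r p)) /
      (P ^ Suc r * P ^ r * P ^ (r * r))"
    unfolding unit_density_def card_unit_mats_Suc[OF assms] P_def[symmetric] by (simp only: power_add)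
  also have "\<dots> = (1 - 1 / P ^ Suc r) * unit_density r p"
    using P unfolding unit_density_def P_def[symmetric] by (simp add: divide_simps)
  also have "1 / P ^ Suc r = P powi (- int (Suc r))"
    using P by (simp only: power_int_minus power_int_of_nat inverse_eq_divide)
  finally show ?case
    using Suc by (simp add: P_def mult.commute)
qed

section \<open>Ramanujan sums and the trace formula\<close>

text \<open>A character of modulus \<open>d * m\<close> with frequency divisible by \<open>d\<close>
  is a character of modulus \<open>m\<close>, so the summand factors through reduction modulo
  \<open>m\<close>.\<close>

lemma trace_char_sum_lift:
  assumes "d > 0" "m > 0"
  shows "trace_char_sum r (d * m) (int d * j) = of_nat d ^ (r * r) *
    (\<Prod>p | prime p \<and> p dvd d * m \<and> \<not> p dvd m. unit_density r p) * trace_char_sum r m j"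
proof -
  have "trace_char_sum r (d * m) (int d * j) =
      (\<Sum>X\<in>unit_mats r (d * m). echar m (j * mat_trace (mat_mod m X)))"
    unfolding trace_char_sum_def
  proof (intro sum.cong refl)
    fix X assume "X \<in> unit_mats r (d * m)"
    then have "[j * mat_trace X = j * mat_trace (mat_mod m X)] (mod int m)"
      by (intro cong_mult[OF cong_refl] cong_sym[OF cong_mat_trace_mat_mod[of X r]] unit_mats_carrier)
    then show "echar (d * m) (int d * j * mat_trace X) = echar m (j * mat_trace (mat_mod m X))"
      using echar_cong[OF assms(2)] assms(1) by (simp add: mult.assoc echar_mult_cancel)
  qed
  then show ?thesis
    using sum_unit_mats_lift[OF assms, where r = r and f = "\<lambda>X. echar m (j * mat_trace X)"]
    by (simp only: trace_char_sum_def)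
qed

text \<open>Ramanujan sums are the trace sums of 1 by 1 matrices, and the density of units modulo a
  prime is \<open>1 - 1 / p\<close>.\<close>

lemma ramanujan_sum_lift:
  assumes "d > 0" "m > 0"
  shows "ramanujan_sum (d * m) (int d * j) = of_nat d *
    (\<Prod>p | prime p \<and> p dvd d * m \<and> \<not> p dvd m. 1 - of_nat p powi (- 1)) * ramanujan_sum m j"
proof -
  have "(\<Prod>p | prime p \<and> p dvd d * m \<and> \<not> p dvd m. unit_density 1 p) =
      (\<Prod>p | prime p \<and> p dvd d * m \<and> \<not> p dvd m. 1 - of_nat p powi (- 1))"
    by (intro prod.cong refl) (simp add: unit_density_prime)
  then show ?thesis
    using trace_char_sum_lift[OF assms, of 1 j] assms by (simp add: trace_char_sum_1[simplified])
qed

lemma ramanujan_sum_0: "ramanujan_sum n 0 = of_nat (totient n)"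
  by (simp add: ramanujan_sum_echar totient_def)

text \<open>Comparing the lifting identity at \<open>k\<close> with the one at 0, where the
  Ramanujan sum is a totient, eliminates the product over primes.\<close>

lemma ramanujan_sum_totient:
  assumes "n > 0" "d dvd n"
  shows "ramanujan_sum n (int d * k) * of_nat (totient (n div d)) =
    of_nat (totient n) * ramanujan_sum (n div d) k"
proof -
  obtain m where n: "n = d * m" using assms(2) ..
  with assms have pos: "d > 0" "m > 0" by auto
  show ?thesis
    using ramanujan_sum_lift[OF pos, of k] ramanujan_sum_lift[OF pos, of 0] pos
    by (simp add: n ramanujan_sum_0)
qed

lemma ramanujan_sum_swap:
  assumes "n > 0" "d dvd n" "int l = gcd \<beta> (int n)"
  shows "ramanujan_sum (n div d) \<beta> =
    of_nat (totient (n div d)) / of_nat (totient (n div l)) * ramanujan_sum (n div l) (int d)"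
proof -
  have "int l dvd int n" unfolding assms(3) by simp
  then have l: "l dvd n" by simp
  have "l \<noteq> 0" using assms(1) l by auto
  define b where "b = \<beta> div int l"
  have \<beta>: "\<beta> = int l * b" by (simp add: b_def assms(3))
  have "coprime b (int (n div l))"
    using div_gcd_coprime[of \<beta> "int n"] assms(1) by (simp add: b_def zdiv_int flip: assms(3))
  then have "ramanujan_sum (n div l) (b * int d) = ramanujan_sum (n div l) (int d)"
    using assms(1) l by (intro ramanujan_sum_mult_coprime) (auto simp: dvd_div_eq_0_iff intro: Nat.gr0I)
  then have "ramanujan_sum n (int d * \<beta>) * of_nat (totient (n div l)) =
      of_nat (totient n) * ramanujan_sum (n div l) (int d)"
    using ramanujan_sum_totient[OF assms(1) l, of "b * int d"] by (simp add: \<beta> mult_ac)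
  moreover have "ramanujan_sum n (int d * \<beta>) * of_nat (totient (n div d)) =
      of_nat (totient n) * ramanujan_sum (n div d) \<beta>"
    by (rule ramanujan_sum_totient[OF assms(1,2)])
  moreover have "totient n \<noteq> 0" "totient (n div l) \<noteq> 0" "totient (n div d) \<noteq> 0"
    using assms(1,2) l by (auto simp: dvd_div_eq_0_iff)
  ultimately have "of_nat (totient n) * (ramanujan_sum (n div d) \<beta> * of_nat (totient (n div l))) =
      of_nat (totient n) * (of_nat (totient (n div d)) * ramanujan_sum (n div l) (int d))"
    by (metis (no_types, opaque_lifting) mult.assoc mult.commute)
  with \<open>totient n \<noteq> 0\<close> \<open>totient (n div l) \<noteq> 0\<close> show ?thesis
    by (simp add: field_simps)
qed

section \<open>Assembly of the trace count over the divisors of \<open>n\<close>\<close>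

lemma card_unit_mats_trace:
  assumes "n > 0"
  shows "of_nat n * of_nat (card {X \<in> unit_mats r n. [residue_trace n X = \<beta>] (mod int n)}) =
    (\<Sum>k\<in>{0<..n}. echar n (- (int k * \<beta>)) * trace_char_sum r n (int k))"
proof -
  have cong: "[residue_trace n X = \<beta>] (mod int n) \<longleftrightarrow> int n dvd mat_trace X - \<beta>" for X
    by (simp add: residue_trace_def mat_trace_def cong_iff_dvd_diff[symmetric] cong_def)
  have "(\<Sum>k\<in>{0<..n}. echar n (- (int k * \<beta>)) * trace_char_sum r n (int k)) =
      (\<Sum>k\<in>{0<..n}. \<Sum>X\<in>unit_mats r n. echar n (int k * (mat_trace X - \<beta>)))"
    by (simp add: trace_char_sum_def sum_distrib_left algebra_simps flip: echar_add)
  also have "\<dots> = (\<Sum>X\<in>unit_mats r n. \<Sum>k\<in>{0<..n}. echar n (int k * (mat_trace X - \<beta>)))"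
    by (rule sum.swap)
  also have "\<dots> = (\<Sum>X\<in>unit_mats r n. if int n dvd mat_trace X - \<beta> then of_nat n else 0)"
    by (simp only: sum_echar[OF assms])
  also have "\<dots> = (\<Sum>X\<in>{X \<in> unit_mats r n. int n dvd mat_trace X - \<beta>}. of_nat n)"
    by (rule sum.inter_filter[symmetric]) simp
  finally show ?thesis by (simp add: cong mult.commute)
qed

lemma sum_gcd_divisors:
  fixes f :: "nat \<Rightarrow> complex"
  assumes "n > 0"
  shows "(\<Sum>k\<in>{0<..n}. f k) = (\<Sum>d | d dvd n. \<Sum>j\<in>totatives (n div d). f (j * d))"
proof -
  have "(\<Sum>k\<in>{0<..n}. f k) = (\<Sum>d | d dvd n. \<Sum>k\<in>{k \<in> {0<..n}. gcd k n = d}. f k)"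
    using assms by (intro sum.group[symmetric]) auto
  also have "\<dots> = (\<Sum>d | d dvd n. \<Sum>j\<in>totatives (n div d). f (j * d))"
    using assms by (intro sum.cong refl sum.reindex_bij_betw[symmetric] bij_betw_totatives_gcd_eq) auto
  finally show ?thesis .
qed

text \<open>Contribution of the frequencies \<open>k\<close> with \<open>gcd k n = d\<close>. The
  power of \<open>n\<close> is one higher than in the final formula, because character orthogonality
  yields \<open>n\<close> times the count.\<close>

lemma sum_divisor_stratum:
  assumes "n > 0" "d dvd n" "int l = gcd \<beta> (int n)"
  shows "(\<Sum>j\<in>totatives (n div d). echar n (- (int (j * d) * \<beta>)) * trace_char_sum r n (int (j * d))) =
    1 / of_nat (totient (n div l)) * of_nat n ^ (r * (r - 1) div 2) *
    (ramanujan_sum (n div l) (int d) * ramanujan_sum n (int d) ^ r *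
     of_nat (totient (n div d)) * of_nat d ^ (r * (r - 1) div 2) *
     (\<Prod>p | prime p \<and> p dvd n \<and> \<not> p dvd n div d.
        \<Prod>i = 1..r. (1 - of_nat p powi (- int i)) / (1 - of_nat p powi (- 1))))"
proof -
  obtain m where n: "n = d * m" using assms(2) ..
  with assms(1) have pos: "d > 0" "m > 0" by auto
  then have m: "n div d = m" by (simp add: n)
  define T where "T = r * (r - 1) div 2"
  define P where "P = {p. prime p \<and> p dvd n \<and> \<not> p dvd m}"
  define D where "D = (\<Prod>p\<in>P. unit_density r p)"
  define E where "E = (\<Prod>p\<in>P. 1 - complex_of_nat p powi (- 1))"
  define C where "C = ramanujan_sum m 1"
  have fin: "finite P"
    using assms(1) by (intro finite_subset[OF _ finite_divisors_nat[of n]]) (auto simp: P_def)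
  \<comment> \<open>\<open>E ^ r\<close> occurs inside \<open>ramanujan_sum n (int d) ^ r\<close>
    and as the denominator of the product over primes; being nonzero, it cancels.\<close>
  have E0: "E \<noteq> 0"
  proof -
    have "1 - complex_of_nat p powi (- 1) \<noteq> 0" if "p \<in> P" for p
      using that prime_gt_1_nat[of p] by (auto simp: P_def power_int_minus field_simps)
    then show ?thesis using fin by (simp add: E_def)
  qed
  have term_eq: "echar n (- (int (j * d) * \<beta>)) * trace_char_sum r n (int (j * d)) =
      echar m (int j * (- \<beta>)) * (of_nat d ^ (r * r) * D * (of_nat m ^ T * C ^ r))"
    if "j \<in> totatives m" for j
  proof -
    have "coprime (int j) (int m)"
      using that by (simp add: in_totatives_iff)
    then have "trace_char_sum r n (int d * int j) = of_nat d ^ (r * r) * D * (of_nat m ^ T * C ^ r)"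
      unfolding n trace_char_sum_lift[OF pos]
      by (simp add: trace_char_sum_coprime[OF pos(2)] D_def P_def T_def C_def n)
    moreover have "echar n (int d * (int j * (- \<beta>))) = echar m (int j * (- \<beta>))"
      unfolding n by (rule echar_mult_cancel[OF pos(1)])
    ultimately show ?thesis by (simp add: mult_ac)
  qed
  \<comment> \<open>The powers are redistributed by \<open>r * r = r + T + T\<close>:
    \<open>d ^ r\<close> belongs to the Ramanujan sums, one \<open>d ^ T\<close> merges with
    \<open>m ^ T\<close> into \<open>n ^ T\<close>, and the other stays in the summand.\<close>
  have "2 * T = r * (r - 1)"
    unfolding T_def by (cases r) simp_all
  then have "r * r = r + T + T"
    by (cases r) simp_all
  then have pow: "complex_of_nat d ^ (r * r) * of_nat m ^ T = of_nat d ^ r * of_nat d ^ T * of_nat n ^ T"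
    by (simp add: power_add n power_mult_distrib)
  have "ramanujan_sum n (int d) = of_nat d * E * C"
    using ramanujan_sum_lift[OF pos, of 1] by (simp add: n E_def P_def C_def)
  moreover have "(\<Prod>p\<in>P. \<Prod>i = 1..r. (1 - complex_of_nat p powi (- int i)) / (1 - of_nat p powi (- 1))) = D / E ^ r"
  proof -
    have "(\<Prod>i = 1..r. (1 - complex_of_nat p powi (- int i)) / (1 - of_nat p powi (- 1))) =
        unit_density r p / (1 - of_nat p powi (- 1)) ^ r" if "p \<in> P" for p
    proof -
      have "prime p" using that by (simp add: P_def)
      then show ?thesis by (simp only: unit_density_prime prod_dividef prod_constant card_atLeastAtMost) simp
    qed
    then have "(\<Prod>p\<in>P. \<Prod>i = 1..r. (1 - complex_of_nat p powi (- int i)) / (1 - of_nat p powi (- 1))) =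
        (\<Prod>p\<in>P. unit_density r p / (1 - of_nat p powi (- 1)) ^ r)"
      by (rule prod.cong[OF refl])
    then show ?thesis
      by (simp only: D_def E_def prod_dividef prod_power_distrib)
  qed
  ultimately have key: "ramanujan_sum n (int d) ^ r *
      (\<Prod>p\<in>P. \<Prod>i = 1..r. (1 - complex_of_nat p powi (- int i)) / (1 - of_nat p powi (- 1))) =
      of_nat d ^ r * C ^ r * D"
    using E0 by (simp add: power_mult_distrib)
  have "(\<Sum>j\<in>totatives m. echar n (- (int (j * d) * \<beta>)) * trace_char_sum r n (int (j * d))) =
      ramanujan_sum m (- \<beta>) * (of_nat d ^ (r * r) * D * (of_nat m ^ T * C ^ r))"
    unfolding ramanujan_sum_echar[of m "- \<beta>"] sum_distrib_right
    by (intro sum.cong refl term_eq)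
  \<comment> \<open>The sign disappears because -1 is a unit modulo \<open>m\<close>.\<close>
  also have "ramanujan_sum m (- \<beta>) = ramanujan_sum m \<beta>"
    using ramanujan_sum_mult_coprime[OF pos(2), of "- 1" \<beta>] by simp
  also have "\<dots> = of_nat (totient m) / of_nat (totient (n div l)) * ramanujan_sum (n div l) (int d)"
    using ramanujan_sum_swap[OF assms] by (simp only: m)
  also have "of_nat d ^ (r * r) * D * (of_nat m ^ T * C ^ r) =
      of_nat d ^ T * of_nat n ^ T * (of_nat d ^ r * C ^ r * D)"
    using arg_cong[OF pow, of "\<lambda>x. x * (C ^ r * D)"] by (simp add: mult_ac)
  finally show ?thesis
    unfolding m P_def[symmetric] T_def[symmetric] key[symmetric] by (simp add: mult_ac)
qed

theorem theorem6:
  fixes n r l :: nat and \<beta> :: int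
  assumes "n \<ge> 1" and "r \<ge> 1"
    and "int l = gcd \<beta> (int n)"
  shows "of_nat (card {X \<in> GL_residue r n. [residue_trace n X = \<beta>] (mod int n)}) =
    1 / of_nat (totient (n div l)) * of_nat n powi (int (r * (r - 1) div 2) - 1) *
    (\<Sum>d | d dvd n.
       ramanujan_sum (n div l) (int d) * ramanujan_sum n (int d) ^ r *
       of_nat (totient (n div d)) * of_nat d ^ (r * (r - 1) div 2) *
       (\<Prod>p | prime p \<and> p dvd n \<and> \<not> p dvd n div d.
          \<Prod>i = 1..r. (1 - of_nat p powi (- int i)) / (1 - of_nat p powi (- 1))))"
    (is "?N = ?a * _ * sum ?F _")
proof -
  have n: "n > 0" using assms(1) by simp
  define T where "T = r * (r - 1) div 2"
  have "of_nat n * ?N = (\<Sum>d | d dvd n. \<Sum>j\<in>totatives (n div d).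
      echar n (- (int (j * d) * \<beta>)) * trace_char_sum r n (int (j * d)))"
    unfolding GL_residue_eq_unit_mats[OF n] card_unit_mats_trace[OF n] by (rule sum_gcd_divisors[OF n])
  also have "\<dots> = (\<Sum>d | d dvd n. ?a * of_nat n ^ T * ?F d)"
    unfolding T_def by (intro sum.cong refl sum_divisor_stratum[OF n _ assms(3)]) simp
  also have "\<dots> = ?a * of_nat n ^ T * sum ?F {d. d dvd n}"
    by (rule sum_distrib_left[symmetric])
  finally have "of_nat n * ?N = ?a * of_nat n ^ T * sum ?F {d. d dvd n}" .
  \<comment> \<open>For \<open>r = 1\<close> the exponent \<open>T - 1\<close> is -1, hence the
    integer power.\<close>
  moreover have "of_nat n powi (int T - 1) = of_nat n ^ T / (of_nat n :: complex)"
    using n by (simp add: power_int_diff)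
  ultimately have "of_nat n * ?N = of_nat n * (?a * of_nat n powi (int T - 1) * sum ?F {d. d dvd n})"
    using n by simp
  then show ?thesis
    unfolding T_def[symmetric] mult_cancel_left using n by simp
qed

end
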